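(* For $\ell=1,\dots,L$ let $K^\ell\subseteq\mathbb{R}^{n_1^\ell+n_2^\ell}$ be a regular cone, $c^\ell\in\mathbb{R}^{n_1^\ell}$, $d^\ell\in\mathbb{R}^{n_2^\ell}$, $A^\ell\in\mathbb{R}^{m\times n_1^\ell}$, $G^\ell\in\mathbb{R}^{m\times n_2^\ell}$, and let $b\in\mathbb{R}^m$. Assume that the conic mixed-integer program with block structure $$\inf\Big\{\sum_{\ell=1}^L\big[{c^\ell}^Tx^\ell+{d^\ell}^Ty^\ell\big] : \sum_{\ell=1}^L\big[A^\ell x^\ell+G^\ell y^\ell\big]=b,\ (x^\ell,y^\ell)\in K^\ell\cap(\mathbb{Z}^{n_1^\ell}\times\mathbb{R}^{n_2^\ell}),\ \ell=1,\dots,L\Big\}$$ is feasible. Let $a_i^\ell$ and $g_i^\ell$ denote the $i$-th rows of $A^\ell$ and $G^\ell$, viewed as column vectors. Let $\alpha\in\mathbb{R}^m$ and define $$E'=\left\{\ell : \begin{bmatrix}c^\ell-{A^\ell}^T\alpha\\ d^\ell-{G^\ell}^T\alpha\end{bmatrix}\in K^\ell_*\ \text{ and }\ \begin{bmatrix}a_i^\ell\\ g_i^\ell\end{bmatrix}\in K^\ell_*\ \text{ for all } i=1,\dots,m\right\},\qquad E=\{1,\dots,L\}\setminus E'.$$ Then, for every $\omega\in\Omega^\leq$, the generator subadditive function $F_\alpha$ of this problem satisfies $$F_\alpha(\omega)=\alpha^T\omega-\sup\Big\{\sum_{\ell\in E}\big[({A^\ell}^T\alpha-c^\ell)^Tx^\ell+({G^\ell}^T\alpha-d^\ell)^Ty^\ell\big]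 : \sum_{\ell\in E}\big[A^\ell x^\ell+G^\ell y^\ell\big]\le\omega,\ (x^\ell,y^\ell)\in K^\ell\cap(\mathbb{Z}^{n_1^\ell}\times\mathbb{R}^{n_2^\ell}),\ \ell=1,\dots,L\Big\}.$$
   Context: A cone $K$ is regular if it is closed, convex, pointed and full-dimensional. The dual cone is $K_*=\{y: x^Ty\ge0\text{ for all }x\in K\}$. Vector inequalities $\le$ in $\mathbb{R}^m$ are componentwise. For the block-structured problem, $\Omega^\leq$ is the set of $\omega\in\mathbb{R}^m$ for which there exist $(x^\ell,y^\ell)\in K^\ell\cap(\mathbb{Z}^{n_1^\ell}\times\mathbb{R}^{n_2^\ell})$, $\ell=1,\dots,L$, with $\sum_{\ell=1}^L[A^\ell x^\ell+G^\ell y^\ell]\le\omega$. The generator subadditive function $F_\alpha:\Omega^\leq\to\mathbb{R}\cup\{-\infty\}$ is $$F_\alpha(\omega)=\alpha^T\omega-\sup\Big\{\sum_{\ell=1}^L\big[({A^\ell}^T\alpha-c^\ell)^Tx^\ell+({G^\ell}^T\alpha-d^\ell)^Ty^\ell\big] : \sum_{\ell=1}^L\big[A^\ell x^\ell+G^\ell y^\ell\big]\le\omega,\ (x^\ell,y^\ell)\in K^\ell\cap(\mathbb{Z}^{n_1^\ell}\times\mathbb{R}^{n_2^\ell}),\ \ell=1,\dots,L\Big\}.$$ *)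

theory Defs
  imports
    "HOL-Analysis.Abstract_Euclidean_Space"
    "HOL-Library.Extended_Real"
    "Jordan_Normal_Form.Matrix"
begin

unbundle no inner_syntax

text \<open>
  Block dimensions vary with the block index, so vectors and matrices are those of
  Jordan_Normal_Form, with dimensions enforced by carriers.  That vector type carries no
  topology; sets of vectors are transported to the library topology
  \<^const>\<open>Euclidean_space\<close> on sequences vanishing from position \<open>n\<close> on.
\<close>

definition vec_seq :: "real Matrix.vec \<Rightarrow> nat \<Rightarrow> real" where
  "vec_seq v = (\<lambda>i. if i < dim_vec v then vec_index v i else 0)"

definition regular_cone :: "nat \<Rightarrow> real Matrix.vec set \<Rightarrow> bool" where
  "regular_cone n K \<longleftrightarrow>
     K \<subseteq> carrier_vec n \<and>
     (\<forall>v\<in>K. \<forall>t\<ge>0. t \<cdot>\<^sub>v v \<in> K) \<and>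
     closedin (Euclidean_space n) (vec_seq ` K) \<and>
     (\<forall>v\<in>K. \<forall>w\<in>K. \<forall>s\<ge>0. \<forall>t\<ge>0. s + t = 1 \<longrightarrow> s \<cdot>\<^sub>v v + t \<cdot>\<^sub>v w \<in> K) \<and>
     (\<forall>v. v \<in> K \<and> - v \<in> K \<longrightarrow> v = 0\<^sub>v n) \<and>
     Euclidean_space n interior_of (vec_seq ` K) \<noteq> {}"

definition dual_cone :: "nat \<Rightarrow> real Matrix.vec set \<Rightarrow> real Matrix.vec set" where
  "dual_cone n K = {y \<in> carrier_vec n. \<forall>x\<in>K. x \<bullet> y \<ge> 0}"

definition mixed_int_cone ::
  "nat \<Rightarrow> nat \<Rightarrow> real Matrix.vec set \<Rightarrow> (real Matrix.vec \<times> real Matrix.vec) set" where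
  "mixed_int_cone n1 n2 K =
     {(x, y). x \<in> carrier_vec n1 \<and> (\<forall>i<n1. vec_index x i \<in> \<int>) \<and> y \<in> carrier_vec n2 \<and>
              x @\<^sub>v y \<in> K}"

text \<open>
  Families indexed by blocks are total functions on \<^typ>\<open>nat\<close>; only the values at
  \<open>1, \<dots>, L\<close> matter.
\<close>

definition block_points ::
  "nat \<Rightarrow> (nat \<Rightarrow> nat) \<Rightarrow> (nat \<Rightarrow> nat) \<Rightarrow> (nat \<Rightarrow> real Matrix.vec set) \<Rightarrow>
   ((nat \<Rightarrow> real Matrix.vec) \<times> (nat \<Rightarrow> real Matrix.vec)) set" where
  "block_points L n1 n2 K = {(x, y). \<forall>l\<in>{1..L}. (x l, y l) \<in> mixed_int_cone (n1 l) (n2 l) (K l)}"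

definition block_lhs ::
  "nat \<Rightarrow> (nat \<Rightarrow> real Matrix.mat) \<Rightarrow> (nat \<Rightarrow> real Matrix.mat) \<Rightarrow> nat set \<Rightarrow>
   (nat \<Rightarrow> real Matrix.vec) \<Rightarrow> (nat \<Rightarrow> real Matrix.vec) \<Rightarrow> real Matrix.vec" where
  "block_lhs m A G S x y = finsum_vec TYPE(real) m (\<lambda>l. A l *\<^sub>v x l + G l *\<^sub>v y l) S"

definition block_feasible ::
  "nat \<Rightarrow> nat \<Rightarrow> (nat \<Rightarrow> nat) \<Rightarrow> (nat \<Rightarrow> nat) \<Rightarrow> (nat \<Rightarrow> real Matrix.vec set) \<Rightarrow>
   (nat \<Rightarrow> real Matrix.mat) \<Rightarrow> (nat \<Rightarrow> real Matrix.mat) \<Rightarrow> real Matrix.vec \<Rightarrow> bool" where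
  "block_feasible L m n1 n2 K A G b \<longleftrightarrow>
     (\<exists>(x, y) \<in> block_points L n1 n2 K. block_lhs m A G {1..L} x y = b)"

definition Omega_le ::
  "nat \<Rightarrow> nat \<Rightarrow> (nat \<Rightarrow> nat) \<Rightarrow> (nat \<Rightarrow> nat) \<Rightarrow> (nat \<Rightarrow> real Matrix.vec set) \<Rightarrow>
   (nat \<Rightarrow> real Matrix.mat) \<Rightarrow> (nat \<Rightarrow> real Matrix.mat) \<Rightarrow> real Matrix.vec set" where
  "Omega_le L m n1 n2 K A G =
     {\<omega> \<in> carrier_vec m. \<exists>(x, y) \<in> block_points L n1 n2 K. block_lhs m A G {1..L} x y \<le> \<omega>}"

text \<open>
  The value is never \<open>\<infinity>\<close> on \<^const>\<open>Omega_le\<close>, where the supremum is over a nonempty set.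
\<close>

definition gen_subadditive ::
  "nat \<Rightarrow> nat \<Rightarrow> (nat \<Rightarrow> nat) \<Rightarrow> (nat \<Rightarrow> nat) \<Rightarrow> (nat \<Rightarrow> real Matrix.vec set) \<Rightarrow>
   (nat \<Rightarrow> real Matrix.mat) \<Rightarrow> (nat \<Rightarrow> real Matrix.mat) \<Rightarrow>
   (nat \<Rightarrow> real Matrix.vec) \<Rightarrow> (nat \<Rightarrow> real Matrix.vec) \<Rightarrow>
   real Matrix.vec \<Rightarrow> real Matrix.vec \<Rightarrow> ereal" where
  "gen_subadditive L m n1 n2 K A G c d \<alpha> \<omega> =
     ereal (\<alpha> \<bullet> \<omega>) -
     (SUP (x, y) \<in> {(x, y) \<in> block_points L n1 n2 K. block_lhs m A G {1..L} x y \<le> \<omega>}.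
        ereal (\<Sum>l\<in>{1..L}. (transpose_mat (A l) *\<^sub>v \<alpha> - c l) \<bullet> x l +
                            (transpose_mat (G l) *\<^sub>v \<alpha> - d l) \<bullet> y l))"

end

theory Submission
  imports Defs
begin

text \<open>
  Blocks in \<open>E'\<close> contribute a nonnegative vector to the constraint and a nonpositive number to the
  objective. Hence replacing their variables by \<open>0\<close> preserves feasibility and does not decrease the
  objective, so they can be dropped from the supremum.
\<close>

text \<open>The nonempty interior in \<open>regular_cone\<close> supplies a point of
  \<open>K\<close>, and scaling it by 0 stays in the cone. This is where full dimension
  enters.\<close>

lemma regular_cone_zero:
  assumes "regular_cone n K"
  shows "0\<^sub>v n \<in> K"
proof -
  have "K \<noteq> {}"
    using assms unfolding regular_cone_def by auto
  then obtain v where v: "v \<in> K" by blast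
  have "0 \<cdot>\<^sub>v v \<in> K" and "v \<in> carrier_vec n"
    using assms v unfolding regular_cone_def by auto
  moreover from this have "0 \<cdot>\<^sub>v v = 0\<^sub>v n" by auto
  ultimately show ?thesis by simp
qed

text \<open>Makes 0 an admissible value for a block: it lies in the cone, and its first part is
  integral.\<close>

lemma zero_mem_mixed_int_cone:
  assumes "regular_cone (n1 + n2) K"
  shows "(0\<^sub>v n1, 0\<^sub>v n2) \<in> mixed_int_cone n1 n2 K"
proof -
  have "0\<^sub>v n1 @\<^sub>v 0\<^sub>v n2 = (0\<^sub>v (n1 + n2) :: real Matrix.vec)" by auto
  then show ?thesis
    using regular_cone_zero[OF assms] by (simp add: mixed_int_cone_def)
qed

text \<open>Common source of both sign facts about \<open>E'\<close>: \<open>(u, v)\<close> is later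
  a row of the two constraint matrices, or the cost vector minus the transposed matrices applied to
  \<alpha>.\<close>

lemma mixed_int_cone_scalar_prod_nonneg:
  assumes "(x, y) \<in> mixed_int_cone n1 n2 K" "u @\<^sub>v v \<in> dual_cone (n1 + n2) K"
    and "u \<in> carrier_vec n1" "v \<in> carrier_vec n2"
  shows "0 \<le> u \<bullet> x + v \<bullet> y"
proof -
  have x: "x \<in> carrier_vec n1" and y: "y \<in> carrier_vec n2"
    using assms(1) by (auto simp: mixed_int_cone_def)
  have "0 \<le> (x @\<^sub>v y) \<bullet> (u @\<^sub>v v)"
    using assms(1,2) by (auto simp: mixed_int_cone_def dual_cone_def)
  also have "\<dots> = x \<bullet> u + y \<bullet> v"
    by (rule scalar_prod_append[OF x y assms(3,4)])
  also have "\<dots> = u \<bullet> x + v \<bullet> y"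
    using comm_scalar_prod[OF x assms(3)] comm_scalar_prod[OF y assms(4)] by simp
  finally show ?thesis .
qed

text \<open>A product \<open>A l *\<^sub>v x l\<close> has as many entries as \<open>A l\<close> has
  rows, whatever vector \<open>x l\<close> is, so every summand has dimension
  \<open>m\<close>.\<close>

lemma dim_block_lhs:
  assumes "\<And>l. l \<in> S \<Longrightarrow> A l \<in> carrier_mat m (n1 l)" "\<And>l. l \<in> S \<Longrightarrow> G l \<in> carrier_mat m (n2 l)"
  shows "dim_vec (block_lhs m A G S x y) = m"
proof -
  have "block_lhs m A G S x y \<in> carrier_vec m"
    unfolding block_lhs_def by (intro finsum_vec_closed) (auto intro!: carrier_vecI simp: assms[THEN carrier_matD(1)])
  then show ?thesis by simp
qed

text \<open>Turns vector comparisons into comparisons of real sums over blocks, to which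
  monotonicity and the removal of zero terms apply.\<close>

lemma index_block_lhs:
  assumes "finite S" "i < m"
    and "\<And>l. l \<in> S \<Longrightarrow> A l \<in> carrier_mat m (n1 l)" "\<And>l. l \<in> S \<Longrightarrow> G l \<in> carrier_mat m (n2 l)"
  shows "vec_index (block_lhs m A G S x y) i =
    (\<Sum>l\<in>S. Matrix.row (A l) i \<bullet> x l + Matrix.row (G l) i \<bullet> y l)"
proof -
  have "vec_index (block_lhs m A G S x y) i = (\<Sum>l\<in>S. vec_index (A l *\<^sub>v x l + G l *\<^sub>v y l) i)"
    unfolding block_lhs_def using assms(1,2)
    by (intro index_finsum_vec) (auto intro!: carrier_vecI simp: assms(3,4)[THEN carrier_matD(1)])
  also have "\<dots> = (\<Sum>l\<in>S. Matrix.row (A l) i \<bullet> x l + Matrix.row (G l) i \<bullet> y l)"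
    using assms(2) by (intro sum.cong refl) (simp add: assms(3,4)[THEN carrier_matD(1)])
  finally show ?thesis .
qed

text \<open>Domination value by value in both directions makes the suprema equal, whether or not
  they are attained or finite.\<close>

lemma SUP_ereal_eq_of_mutual_domination:
  fixes f g :: "'a \<Rightarrow> real"
  assumes "\<And>p. p \<in> P \<Longrightarrow> \<exists>q\<in>Q. f p \<le> g q" "\<And>q. q \<in> Q \<Longrightarrow> \<exists>p\<in>P. g q \<le> f p"
  shows "(SUP p\<in>P. ereal (f p)) = (SUP q\<in>Q. ereal (g q))"
  by (rule SUP_eq) (use assms in auto)

theorem proposition8:
  fixes L m :: nat
    and n1 n2 :: "nat \<Rightarrow> nat"
    and K :: "nat \<Rightarrow> real Matrix.vec set"
    and A G :: "nat \<Rightarrow> real Matrix.mat"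
    and c d :: "nat \<Rightarrow> real Matrix.vec"
    and b \<alpha> :: "real Matrix.vec"
    and E E' :: "nat set"
  assumes "\<forall>l\<in>{1..L}. regular_cone (n1 l + n2 l) (K l)"
    and "\<forall>l\<in>{1..L}. c l \<in> carrier_vec (n1 l) \<and> d l \<in> carrier_vec (n2 l)"
    and "\<forall>l\<in>{1..L}. A l \<in> carrier_mat m (n1 l) \<and> G l \<in> carrier_mat m (n2 l)"
    and "b \<in> carrier_vec m"
    and "block_feasible L m n1 n2 K A G b"
    and "\<alpha> \<in> carrier_vec m"
    and "E' = {l \<in> {1..L}.
           (c l - transpose_mat (A l) *\<^sub>v \<alpha>) @\<^sub>v (d l - transpose_mat (G l) *\<^sub>v \<alpha>)
             \<in> dual_cone (n1 l + n2 l) (K l) \<and>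
           (\<forall>i<m. Matrix.row (A l) i @\<^sub>v Matrix.row (G l) i \<in> dual_cone (n1 l + n2 l) (K l))}"
    and "E = {1..L} - E'"
  shows "\<forall>\<omega> \<in> Omega_le L m n1 n2 K A G.
           gen_subadditive L m n1 n2 K A G c d \<alpha> \<omega> =
           ereal (\<alpha> \<bullet> \<omega>) -
           (SUP (x, y) \<in> {(x, y) \<in> block_points L n1 n2 K. block_lhs m A G E x y \<le> \<omega>}.
              ereal (\<Sum>l\<in>E. (transpose_mat (A l) *\<^sub>v \<alpha> - c l) \<bullet> x l +
                             (transpose_mat (G l) *\<^sub>v \<alpha> - d l) \<bullet> y l))"
proof (intro ballI)
  fix \<omega> :: "real Matrix.vec"
  let ?w = "\<lambda>x y l. (transpose_mat (A l) *\<^sub>v \<alpha> - c l) \<bullet> x l +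
                    (transpose_mat (G l) *\<^sub>v \<alpha> - d l) \<bullet> y l"
  let ?feas = "\<lambda>S. {(x, y) \<in> block_points L n1 n2 K. block_lhs m A G S x y \<le> \<omega>}"
  have sub: "E \<subseteq> {1..L}" "E' \<subseteq> {1..L}"
    and split: "{1..L} - E = E'"
    using assms(7,8) by auto
  have AG: "A l \<in> carrier_mat m (n1 l)" "G l \<in> carrier_mat m (n2 l)" if "l \<in> {1..L}" for l
    using assms(3) that by auto
  have dim: "dim_vec (block_lhs m A G S x y) = m" if "S \<subseteq> {1..L}" for S x y
    by (rule dim_block_lhs[where ?n1.0 = n1 and ?n2.0 = n2]) (use that AG in auto)
  have index: "vec_index (block_lhs m A G S x y) i =
      (\<Sum>l\<in>S. Matrix.row (A l) i \<bullet> x l + Matrix.row (G l) i \<bullet> y l)"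
    if "S \<subseteq> {1..L}" "i < m" for S x y i
    by (rule index_block_lhs[where ?n1.0 = n1 and ?n2.0 = n2])
      (use that AG finite_subset[OF that(1)] in auto)

  \<comment> \<open>This uses the second condition that defines \<open>E'\<close>, the one on the
    rows.\<close>
  have lhs_nonneg: "0 \<le> Matrix.row (A l) i \<bullet> x l + Matrix.row (G l) i \<bullet> y l"
    if "(x, y) \<in> block_points L n1 n2 K" "l \<in> E'" "i < m" for x y l i
  proof (rule mixed_int_cone_scalar_prod_nonneg)
    show "(x l, y l) \<in> mixed_int_cone (n1 l) (n2 l) (K l)"
      using that sub by (auto simp: block_points_def)
    show "Matrix.row (A l) i @\<^sub>v Matrix.row (G l) i \<in> dual_cone (n1 l + n2 l) (K l)"
      using that assms(7) by auto
    have l: "l \<in> {1..L}" using that sub by auto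
    show "Matrix.row (A l) i \<in> carrier_vec (n1 l)" "Matrix.row (G l) i \<in> carrier_vec (n2 l)"
      using AG[OF l] by (auto simp: Matrix.row_def)
  qed
  \<comment> \<open>This uses the first condition that defines \<open>E'\<close>. That condition
    concerns \<open>c l\<close> minus the transposed product, while the objective carries the
    opposite difference; hence the change of sign at the end.\<close>
  have obj_nonpos: "?w x y l \<le> 0"
    if "(x, y) \<in> block_points L n1 n2 K" "l \<in> E'" for x y l
  proof -
    have l: "l \<in> {1..L}" using that sub by auto
    have xy: "(x l, y l) \<in> mixed_int_cone (n1 l) (n2 l) (K l)"
      using that l by (auto simp: block_points_def)
    then have x: "x l \<in> carrier_vec (n1 l)" and y: "y l \<in> carrier_vec (n2 l)"
      by (auto simp: mixed_int_cone_def)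
    have cd: "c l \<in> carrier_vec (n1 l)" "d l \<in> carrier_vec (n2 l)"
      and At: "transpose_mat (A l) *\<^sub>v \<alpha> \<in> carrier_vec (n1 l)"
      and Gt: "transpose_mat (G l) *\<^sub>v \<alpha> \<in> carrier_vec (n2 l)"
      using l assms(2) AG[OF l] by (auto intro!: carrier_vecI)
    have "0 \<le> (c l - transpose_mat (A l) *\<^sub>v \<alpha>) \<bullet> x l + (d l - transpose_mat (G l) *\<^sub>v \<alpha>) \<bullet> y l"
      by (rule mixed_int_cone_scalar_prod_nonneg[OF xy]) (use that assms(7) cd At Gt in auto)
    then show ?thesis
      using minus_scalar_prod_distrib[OF cd(1) At x] minus_scalar_prod_distrib[OF At cd(1) x]
        minus_scalar_prod_distrib[OF cd(2) Gt y] minus_scalar_prod_distrib[OF Gt cd(2) y]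
      by linarith
  qed

  \<comment> \<open>The witness is \<open>p\<close> itself: omitting the blocks in \<open>E'\<close>
    can only raise the objective and lower the left side of the constraint.\<close>
  have drop: "\<exists>q\<in>?feas E. (case p of (x, y) \<Rightarrow> \<Sum>l\<in>{1..L}. ?w x y l) \<le> (case q of (x, y) \<Rightarrow> \<Sum>l\<in>E. ?w x y l)"
    if p: "p \<in> ?feas {1..L}" for p
  proof (rule bexI)
    obtain x y where [simp]: "p = (x, y)" by (cases p)
    have xy: "(x, y) \<in> block_points L n1 n2 K" and le: "block_lhs m A G {1..L} x y \<le> \<omega>"
      using p by auto
    have "(\<Sum>l\<in>{1..L}. ?w x y l) = (\<Sum>l\<in>E'. ?w x y l) + (\<Sum>l\<in>E. ?w x y l)"
      using sum.subset_diff[OF sub(1)] split by simp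
    moreover have "(\<Sum>l\<in>E'. ?w x y l) \<le> 0"
      by (rule sum_nonpos) (rule obj_nonpos[OF xy])
    ultimately show "(case p of (x, y) \<Rightarrow> \<Sum>l\<in>{1..L}. ?w x y l) \<le> (case p of (x, y) \<Rightarrow> \<Sum>l\<in>E. ?w x y l)"
      by simp
    \<comment> \<open>In each coordinate the right side has extra terms exactly for the blocks in
      \<open>E'\<close>, and these are nonnegative.\<close>
    have "block_lhs m A G E x y \<le> block_lhs m A G {1..L} x y"
      unfolding less_eq_vec_def
    proof (intro conjI allI impI)
      show "dim_vec (block_lhs m A G E x y) = dim_vec (block_lhs m A G {1..L} x y)"
        using dim sub by simp
      fix i assume "i < dim_vec (block_lhs m A G {1..L} x y)"
      then have i: "i < m" using dim by simp
      show "vec_index (block_lhs m A G E x y) i \<le> vec_index (block_lhs m A G {1..L} x y) i"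
        unfolding index[OF sub(1) i] index[OF subset_refl i]
        by (rule sum_mono2) (use sub(1) split lhs_nonneg[OF xy _ i] in auto)
    qed
    then have "block_lhs m A G E x y \<le> \<omega>" using le by (rule order_trans)
    then show "p \<in> ?feas E" using xy by simp
  qed
  have pad: "\<exists>p\<in>?feas {1..L}. (case q of (x, y) \<Rightarrow> \<Sum>l\<in>E. ?w x y l) \<le> (case p of (x, y) \<Rightarrow> \<Sum>l\<in>{1..L}. ?w x y l)"
    if q: "q \<in> ?feas E" for q
  proof -
    obtain x y where [simp]: "q = (x, y)" by (cases q)
    have xy: "(x, y) \<in> block_points L n1 n2 K" and le: "block_lhs m A G E x y \<le> \<omega>"
      using q by auto
    \<comment> \<open>A point of \<open>?feas E\<close> still has components in the blocks of
      \<open>E'\<close>, restricted there only by the cones, so it may violate the full constraint.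
      Setting these components to 0 repairs this.\<close>
    define x' where "x' = (\<lambda>l. if l \<in> E then x l else 0\<^sub>v (n1 l))"
    define y' where "y' = (\<lambda>l. if l \<in> E then y l else 0\<^sub>v (n2 l))"
    have xy': "(x', y') \<in> block_points L n1 n2 K"
      using xy assms(1) zero_mem_mixed_int_cone by (auto simp: block_points_def x'_def y'_def)
    \<comment> \<open>The zero blocks contribute nothing, so the constraint for \<open>E\<close>
      carries over to the full problem.\<close>
    have "block_lhs m A G {1..L} x' y' = block_lhs m A G E x y"
    proof (rule eq_vecI)
      show "dim_vec (block_lhs m A G {1..L} x' y') = dim_vec (block_lhs m A G E x y)"
        using dim sub by simp
      fix i assume "i < dim_vec (block_lhs m A G E x y)"
      then have i: "i < m" using dim sub by simp
      show "vec_index (block_lhs m A G {1..L} x' y') i = vec_index (block_lhs m A G E x y) i"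
        unfolding index[OF sub(1) i] index[OF subset_refl i]
      proof (rule sum.mono_neutral_cong_right)
        show "\<forall>l\<in>{1..L} - E. Matrix.row (A l) i \<bullet> x' l + Matrix.row (G l) i \<bullet> y' l = 0"
        proof
          fix l assume l: "l \<in> {1..L} - E"
          then have "Matrix.row (A l) i \<in> carrier_vec (n1 l)" "Matrix.row (G l) i \<in> carrier_vec (n2 l)"
            using AG[of l] by (auto simp: Matrix.row_def)
          then show "Matrix.row (A l) i \<bullet> x' l + Matrix.row (G l) i \<bullet> y' l = 0"
            using l by (simp add: x'_def y'_def)
        qed
      qed (use sub in \<open>auto simp: x'_def y'_def\<close>)
    qed
    with le xy' have "(x', y') \<in> ?feas {1..L}" by simp
    \<comment> \<open>The objective value is likewise unchanged, which is more than the required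
      inequality.\<close>
    moreover have "(\<Sum>l\<in>{1..L}. ?w x' y' l) = (\<Sum>l\<in>E. ?w x y l)"
    proof (rule sum.mono_neutral_cong_right)
      show "\<forall>l\<in>{1..L} - E. ?w x' y' l = 0"
      proof
        fix l assume l: "l \<in> {1..L} - E"
        then have "transpose_mat (A l) *\<^sub>v \<alpha> - c l \<in> carrier_vec (n1 l)"
          "transpose_mat (G l) *\<^sub>v \<alpha> - d l \<in> carrier_vec (n2 l)"
          using AG[of l] assms(2) by (auto intro!: carrier_vecI)
        then show "?w x' y' l = 0"
          using l by (simp add: x'_def y'_def)
      qed
    qed (use sub in \<open>auto simp: x'_def y'_def\<close>)
    ultimately show ?thesis by (intro bexI[of _ "(x', y')"]) auto
  qed
  show "gen_subadditive L m n1 n2 K A G c d \<alpha> \<omega> =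
    ereal (\<alpha> \<bullet> \<omega>) - (SUP (x, y)\<in>?feas E. ereal (\<Sum>l\<in>E. ?w x y l))"
    \<comment> \<open>Both sides subtract a supremum from the same real number, so equality of the
      suprema suffices.\<close>
    using SUP_ereal_eq_of_mutual_domination[OF drop pad]
    by (simp add: gen_subadditive_def case_prod_unfold)
qed

end
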